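(* Let $a>1/2$, let $h\in H^1((-s_0,s_0))$ and $u:=Bh$. Then $u$ satisfies the Robin condition $u'(s_0)=\coth r(a)\,u(s_0)$, $u'(-s_0)=-\coth r(a)\,u(-s_0)$ if and only if $h'(\pm s_0)=0$. Under this condition, for every integer $k$, $$\mathcal{S}_k^{\mathrm{rad}}(Bh,Bh)=\int_{-s_0}^{s_0}\Bigl[B^3(h')^2+\bigl((k^2-1)B^2-2K^2\bigr)\frac{h^2}{B}\Bigr]ds.$$
   Context: For $a>1/2$ put $A(s)=\sqrt{a\cosh(2s)+\tfrac12}$, $B(s)=\sqrt{a\cosh(2s)-\tfrac12}$, $K=K(a)=\sqrt{a^2-\tfrac14}$, and $\varphi(s)=\int_0^s\frac{K}{A(t)^2B(t)}\,dt$. Let $s_0=s_0(a)>0$ be the unique positive solution of $\tanh\varphi(s_0)=\frac{B(s_0)K}{a\sinh(2s_0)}$, and let $r(a)>0$ be defined by $\cosh r(a)=A(s_0)\cosh\varphi(s_0)$. (These are the data of the critical spherical catenoid $\Sigma_a$ in the geodesic ball of radius $r(a)$ of $\mathbb{H}^3$, with $|\mathrm{II}|^2=2K^2/B^4$.) For $k\in\mathbb{Z}$ set $W_k(s)=2K^2/B(s)^4-2-k^2/B(s)^2$ and $$\mathcal{S}_k^{\mathrm{rad}}(u,u)=\int_{-s_0}^{s_0}\bigl[B(u')^2-BW_ku^2\bigr]ds-\coth r(a)\,B(s_0)\bigl[u(s_0)^2+u(-s_0)^2\bigr].$$ Statements involving $u'(\pm s_0)$, $h'(\pm s_0)$ refer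 to functions for which these one-sided endpoint derivatives exist. *)

theory Defs
  imports "HOL-Analysis.Analysis"
begin

subsection \<open>The data of the critical spherical catenoid\<close>

definition cat_A :: "real \<Rightarrow> real \<Rightarrow> real" where
  "cat_A a s = sqrt (a * cosh (2 * s) + 1 / 2)"

definition cat_B :: "real \<Rightarrow> real \<Rightarrow> real" where
  "cat_B a s = sqrt (a * cosh (2 * s) - 1 / 2)"

definition cat_K :: "real \<Rightarrow> real" where
  "cat_K a = sqrt (a\<^sup>2 - 1 / 4)"

definition cat_phi :: "real \<Rightarrow> real \<Rightarrow> real" where
  "cat_phi a s = (LBINT t=0..s. cat_K a / ((cat_A a t)\<^sup>2 * cat_B a t))"

definition cat_s0 :: "real \<Rightarrow> real" where
  "cat_s0 a = (THE s. s > 0 \<and> tanh (cat_phi a s) = cat_B a s * cat_K a / (a * sinh (2 * s)))"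

definition cat_r :: "real \<Rightarrow> real" where
  "cat_r a = (THE r. r > 0 \<and> cosh r = cat_A a (cat_s0 a) * cosh (cat_phi a (cat_s0 a)))"

definition coth :: "real \<Rightarrow> real" where
  "coth x = cosh x / sinh x"

abbreviation cat_I :: "real \<Rightarrow> real set" where
  "cat_I a \<equiv> {- cat_s0 a <..< cat_s0 a}"


subsection \<open>The Sobolev space H1 of an open set of reals\<close>

definition L2_on :: "real set \<Rightarrow> (real \<Rightarrow> real) \<Rightarrow> bool" where
  "L2_on S f \<longleftrightarrow> f \<in> borel_measurable (lebesgue_on S) \<and> integrable (lebesgue_on S) (\<lambda>x. (f x)\<^sup>2)"

text \<open>Test functions are the compactly supported C1 functions, as in Brezis, Functional Analysis,
  Sobolev Spaces and Partial Differential Equations, Section 8.2. By mollification, smooth test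
  functions give the same weak derivatives.\<close>

definition test_fun_on :: "real set \<Rightarrow> (real \<Rightarrow> real) \<Rightarrow> bool" where
  "test_fun_on S \<psi> \<longleftrightarrow> \<psi> C1_differentiable_on UNIV \<and>
     compact (closure {x. \<psi> x \<noteq> 0}) \<and> closure {x. \<psi> x \<noteq> 0} \<subseteq> S"

definition L2_weak_deriv_on :: "real set \<Rightarrow> (real \<Rightarrow> real) \<Rightarrow> (real \<Rightarrow> real) \<Rightarrow> bool" where
  "L2_weak_deriv_on S f g \<longleftrightarrow> L2_on S g \<and>
     (\<forall>\<psi>. test_fun_on S \<psi> \<longrightarrow>
        integral\<^sup>L (lebesgue_on S) (\<lambda>x. f x * deriv \<psi> x) =
        - integral\<^sup>L (lebesgue_on S) (\<lambda>x. g x * \<psi> x))"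

definition H1_on :: "real set \<Rightarrow> (real \<Rightarrow> real) \<Rightarrow> bool" where
  "H1_on S f \<longleftrightarrow> L2_on S f \<and> (\<exists>g. L2_weak_deriv_on S f g)"

text \<open>The weak derivative is determined only up to a null set, so \<open>weak_deriv\<close> picks an arbitrary
  representative. It is used only under integrals, where the choice does not matter.\<close>

definition weak_deriv :: "real set \<Rightarrow> (real \<Rightarrow> real) \<Rightarrow> (real \<Rightarrow> real)" where
  "weak_deriv S f = (SOME g. L2_weak_deriv_on S f g)"


subsection \<open>The radial quadratic form and the Robin condition\<close>

definition cat_W :: "real \<Rightarrow> int \<Rightarrow> real \<Rightarrow> real" where
  "cat_W a k s = 2 * (cat_K a)\<^sup>2 / (cat_B a s)^4 - 2 - (of_int k)\<^sup>2 / (cat_B a s)\<^sup>2"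

text \<open>The endpoint values below are those of the continuous representative, so \<open>u\<close> is meant to be
  continuous on the closed interval.\<close>

definition S_rad :: "real \<Rightarrow> int \<Rightarrow> (real \<Rightarrow> real) \<Rightarrow> real" where
  "S_rad a k u =
     integral\<^sup>L (lebesgue_on (cat_I a))
       (\<lambda>s. cat_B a s * (weak_deriv (cat_I a) u s)\<^sup>2 - cat_B a s * cat_W a k s * (u s)\<^sup>2)
     - coth (cat_r a) * cat_B a (cat_s0 a) * ((u (cat_s0 a))\<^sup>2 + (u (- cat_s0 a))\<^sup>2)"

text \<open>The endpoint derivatives are classical one-sided derivatives, whose existence is part of the
  condition.\<close>

definition robin_cond :: "real \<Rightarrow> (real \<Rightarrow> real) \<Rightarrow> bool" where
  "robin_cond a u \<longleftrightarrow>
     (u has_real_derivative coth (cat_r a) * u (cat_s0 a)) (at_left (cat_s0 a)) \<and>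
     (u has_real_derivative - coth (cat_r a) * u (- cat_s0 a)) (at_right (- cat_s0 a))"

definition neumann_cond :: "real \<Rightarrow> (real \<Rightarrow> real) \<Rightarrow> bool" where
  "neumann_cond a h \<longleftrightarrow>
     (h has_real_derivative 0) (at_left (cat_s0 a)) \<and>
     (h has_real_derivative 0) (at_right (- cat_s0 a))"

end

theory Submission
  imports Defs
begin

text \<open>
  The choice of \<open>s\<^sub>0\<close> and \<open>r(a)\<close> amounts to the identity \<open>coth r(a) = B'(s\<^sub>0) / B(s\<^sub>0)\<close>
  (lemma \<open>coth_cat_r\<close>). Since \<open>(B h)' = B' h + B h'\<close> and \<open>B\<close> is even and positive, the Robin
  condition for \<open>B h\<close> therefore says \<open>h' = 0\<close> at both endpoints (\<open>robin_iff_neumann\<close>).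

  For the quadratic form, insert \<open>u' = B' h + B h'\<close>. The cross term \<open>2 B\<^sup>2 B' h h'\<close> is
  \<open>(B\<^sup>2 B' h\<^sup>2)' - (B\<^sup>2 B')' h\<^sup>2\<close>. The total derivative integrates to \<open>B\<^sup>2 B' h\<^sup>2\<close> between the
  endpoints, which by the same identity equals the boundary term of the form and cancels it. In the
  remaining potential, \<open>B\<^sup>2 = a cosh(2s) - 1/2\<close> gives \<open>(B B')' = 2 B\<^sup>2 + 1\<close>, and this turns it into
  \<open>((k\<^sup>2 - 1) B\<^sup>2 - 2 K\<^sup>2) h\<^sup>2 / B\<close> (\<open>radial_integrand\<close>, \<open>S_rad_eq\<close>).

  Since \<open>h\<close> is only in \<open>H\<^sup>1\<close>, the product rule and the fundamental theorem of calculus are needed up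
  to the endpoints for weak derivatives. They are obtained by passing to indefinite Lebesgue integrals,
  that is, to absolutely continuous functions: a continuous function with an \<open>L\<^sup>2\<close> weak derivative is
  an indefinite integral of it (\<open>L2_weak_deriv_on_imp_ac_primitive\<close>), conversely an indefinite
  integral has its integrand as weak derivative, products of indefinite integrals obey the product
  rule (\<open>ac_primitive_mult\<close>), and the integrand is unique almost everywhere
  (\<open>ac_primitive_AE_unique\<close>). The last fact identifies the arbitrarily chosen representative of the
  weak derivative of \<open>B h\<close>.
\<close>

section \<open>Integrals over intervals\<close>

lemma absolutely_integrable_on_iff_integrable:
  fixes f :: "real \<Rightarrow> real"
  assumes "S \<in> sets lebesgue"
  shows "f absolutely_integrable_on S \<longleftrightarrow> integrable (lebesgue_on S) f"
  using assms by (simp add: integrable_restrict_space set_integrable_def)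

lemma integral_lebesgue_on_Ioo:
  fixes f :: "real \<Rightarrow> real"
  assumes "f absolutely_integrable_on {\<alpha>..\<beta>}"
  shows "integrable (lebesgue_on {\<alpha><..<\<beta>}) f"
    and "integral\<^sup>L (lebesgue_on {\<alpha><..<\<beta>}) f = integral {\<alpha>..\<beta>} f"
proof -
  have "f absolutely_integrable_on {\<alpha><..<\<beta>}"
    using assms absolutely_integrable_on_Icc_iff_Ioo by blast
  then show i: "integrable (lebesgue_on {\<alpha><..<\<beta>}) f"
    by (simp add: absolutely_integrable_on_iff_integrable)
  then have "integral\<^sup>L (lebesgue_on {\<alpha><..<\<beta>}) f = integral {\<alpha><..<\<beta>} f"
    by (simp add: lebesgue_integral_eq_integral)
  then show "integral\<^sup>L (lebesgue_on {\<alpha><..<\<beta>}) f = integral {\<alpha>..\<beta>} f"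
    using integral_open_interval_real[of \<alpha> \<beta> f] by simp
qed

lemma absolutely_integrable_continuous_mult:
  fixes c f :: "real \<Rightarrow> real"
  assumes "continuous_on {\<alpha>..\<beta>} c" "f absolutely_integrable_on {\<alpha>..\<beta>}"
  shows "(\<lambda>x. c x * f x) absolutely_integrable_on {\<alpha>..\<beta>}"
  using assms
  by (intro absolutely_integrable_bounded_measurable_product_real)
    (auto intro: continuous_imp_measurable_on_sets_lebesgue compact_imp_bounded compact_continuous_image)

text \<open>Integration by parts for two indefinite integrals vanishing at \<open>\<alpha>\<close>. By Fubini,
  \<open>F \<beta> * G \<beta>\<close> is the integral of \<open>f x * g y\<close> over the square; the part below the diagonal is the
  integral of \<open>G f\<close>, the part above it that of \<open>F g\<close>.\<close>
lemma integral_mult_triangle: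
  fixes f g :: "real \<Rightarrow> real"
  assumes f: "f absolutely_integrable_on {\<alpha>..\<beta>}" and g: "g absolutely_integrable_on {\<alpha>..\<beta>}"
  defines "F \<equiv> \<lambda>x. integral {\<alpha>..x} f" and "G \<equiv> \<lambda>x. integral {\<alpha>..x} g"
  shows "integral {\<alpha>..\<beta>} (\<lambda>x. G x * f x + F x * g x) = F \<beta> * G \<beta>"
proof -
  define M where "M = lebesgue_on {\<alpha>..\<beta>}"
  interpret M: finite_measure M
    unfolding M_def by (rule finite_measure_lebesgue_on) auto
  interpret pair_sigma_finite M M ..
  have sp [simp]: "space M = {\<alpha>..\<beta>}" by (simp add: M_def)
  have fM: "integrable M f" and gM: "integrable M g"
    using f g by (auto simp: M_def absolutely_integrable_on_iff_integrable)
  note [measurable] = borel_measurable_integrable[OF fM] borel_measurable_integrable[OF gM]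
  have id_M [measurable]: "(\<lambda>x. x) \<in> borel_measurable M"
    unfolding M_def by (intro measurable_restrict_space1 measurable_completion) auto
  have prod: "integrable (M \<Otimes>\<^sub>M M) (\<lambda>(x,y). f x * g y)"
  proof (rule Fubini_integrable)
    show "integrable M (\<lambda>x. \<integral>y. norm (case (x, y) of (x, y) \<Rightarrow> f x * g y) \<partial>M)"
      using fM by (simp add: abs_mult)
  qed (use gM in auto)
  have low: "integrable (M \<Otimes>\<^sub>M M) (\<lambda>(x,y). f x * (if y \<le> x then g y else 0))"
    by (rule Bochner_Integration.integrable_bound[OF prod]) auto
  have upp: "integrable (M \<Otimes>\<^sub>M M) (\<lambda>(x,y). (if x < y then f x else 0) * g y)"
    by (rule Bochner_Integration.integrable_bound[OF prod]) auto
  have cut: "(\<integral>y. (if y \<le> x then k y else 0) \<partial>M) = integral {\<alpha>..x} k"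
    and cut': "(\<integral>y. (if y < x then k y else 0) \<partial>M) = integral {\<alpha>..x} k"
    if k: "integrable M k" and x: "x \<in> {\<alpha>..\<beta>}" for k :: "real \<Rightarrow> real" and x
  proof -
    have [measurable]: "k \<in> borel_measurable M" using k by auto
    have i: "integrable M (\<lambda>y. if y \<le> x then k y else 0)" "integrable M (\<lambda>y. if y < x then k y else 0)"
      by (auto intro: Bochner_Integration.integrable_bound[OF k])
    have e: "{..x} \<inter> {\<alpha>..\<beta>} = {\<alpha>..x}" "{..<x} \<inter> {\<alpha>..\<beta>} = {\<alpha>..<x}" using x by auto
    have "(\<integral>y. (if y \<le> x then k y else 0) \<partial>M) = integral {\<alpha>..\<beta>} (\<lambda>y. if y \<in> {..x} then k y else 0)"
      using i by (simp add: M_def lebesgue_integral_eq_integral)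
    then show "(\<integral>y. (if y \<le> x then k y else 0) \<partial>M) = integral {\<alpha>..x} k"
      by (simp only: integral_restrict_Int e)
    have "(\<integral>y. (if y < x then k y else 0) \<partial>M) = integral {\<alpha>..\<beta>} (\<lambda>y. if y \<in> {..<x} then k y else 0)"
      using i by (simp add: M_def lebesgue_integral_eq_integral)
    also have "\<dots> = integral {\<alpha>..<x} k" by (simp only: integral_restrict_Int e)
    also have "\<dots> = integral {\<alpha>..x} k"
      by (rule integral_subset_negligible) (auto intro: negligible_subset[of "{x}"])
    finally show "(\<integral>y. (if y < x then k y else 0) \<partial>M) = integral {\<alpha>..x} k" .
  qed
  have cont: "continuous_on {\<alpha>..\<beta>} F" "continuous_on {\<alpha>..\<beta>} G"
    unfolding F_def G_def
    using f g set_lebesgue_integral_eq_integral(1) by (blast intro: indefinite_integral_continuous_1)+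
  have Gf: "(\<lambda>x. G x * f x) absolutely_integrable_on {\<alpha>..\<beta>}"
    and Fg: "(\<lambda>x. F x * g x) absolutely_integrable_on {\<alpha>..\<beta>}"
    by (intro absolutely_integrable_continuous_mult cont f g)+
  have whole: "integral {\<alpha>..\<beta>} k = (\<integral>x. k x \<partial>M)" if "k absolutely_integrable_on {\<alpha>..\<beta>}" for k :: "real \<Rightarrow> real"
    using that by (simp add: M_def absolutely_integrable_on_iff_integrable lebesgue_integral_eq_integral)
  have "integral {\<alpha>..\<beta>} (\<lambda>x. G x * f x + F x * g x) = (\<integral>x. G x * f x \<partial>M) + (\<integral>x. F x * g x \<partial>M)"
    using Gf Fg by (simp add: whole[symmetric] integral_add set_lebesgue_integral_eq_integral(1))
  also have "(\<integral>x. G x * f x \<partial>M) = (\<integral>x. (\<integral>y. f x * (if y \<le> x then g y else 0) \<partial>M) \<partial>M)"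
    by (rule Bochner_Integration.integral_cong[OF refl]) (simp add: cut[OF gM] G_def)
  also have "\<dots> = integral\<^sup>L (M \<Otimes>\<^sub>M M) (\<lambda>(x,y). f x * (if y \<le> x then g y else 0))"
    by (rule integral_fst[OF low])
  also have "(\<integral>y. F y * g y \<partial>M) = (\<integral>y. (\<integral>x. (if x < y then f x else 0) * g y \<partial>M) \<partial>M)"
    by (rule Bochner_Integration.integral_cong[OF refl]) (simp add: cut'[OF fM] F_def)
  also have "\<dots> = integral\<^sup>L (M \<Otimes>\<^sub>M M) (\<lambda>(x,y). (if x < y then f x else 0) * g y)"
    by (rule integral_snd[OF upp])
  also have "integral\<^sup>L (M \<Otimes>\<^sub>M M) (\<lambda>(x,y). f x * (if y \<le> x then g y else 0)) + \<dots>
      = integral\<^sup>L (M \<Otimes>\<^sub>M M) (\<lambda>(x,y). f x * g y)"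
    by (subst Bochner_Integration.integral_add[OF low upp, symmetric])
      (auto intro!: Bochner_Integration.integral_cong)
  also have "\<dots> = (\<integral>x. (\<integral>y. f x * g y \<partial>M) \<partial>M)"
    by (rule integral_fst[OF prod, symmetric])
  also have "\<dots> = F \<beta> * G \<beta>"
    by (simp add: F_def G_def whole[OF f] whole[OF g])
  finally show ?thesis .
qed

text \<open>The positive and the negative part of \<open>f\<close> are densities of two finite Borel measures that agree
  on all rays, hence everywhere, so the two densities agree almost everywhere.\<close>
lemma AE_eq_0_if_integral_Ioi_0:
  fixes f :: "real \<Rightarrow> real"
  assumes f: "integrable lborel f" and 0: "\<And>t. (LBINT x:{t<..}. f x) = 0"
  shows "AE x in lborel. f x = 0"
proof -
  note [measurable] = borel_measurable_integrable[OF f]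
  define p n where "p = (\<lambda>x. max 0 (f x))" and "n = (\<lambda>x. max 0 (- f x))"
  have int: "integrable lborel p" "integrable lborel n"
    unfolding p_def n_def using f by auto
  have nn: "p x \<ge> 0" "n x \<ge> 0" for x by (auto simp: p_def n_def)
  note [measurable] = borel_measurable_integrable[OF int(1)] borel_measurable_integrable[OF int(2)]
  have em: "emeasure (density lborel (\<lambda>x. ennreal (k x))) {t<..} = ennreal (LBINT x:{t<..}. k x)"
    if "integrable lborel k" "\<And>x. k x \<ge> 0" for k and t :: real
  proof -
    have [measurable]: "k \<in> borel_measurable lborel" using that by auto
    have "emeasure (density lborel (\<lambda>x. ennreal (k x))) {t<..} = (\<integral>\<^sup>+x. ennreal (indicator {t<..} x * k x) \<partial>lborel)"
      by (subst emeasure_density) (auto intro!: nn_integral_cong simp: indicator_def)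
    also have "\<dots> = ennreal (LBINT x:{t<..}. k x)"
      unfolding set_lebesgue_integral_def
      using that by (subst nn_integral_eq_integral) (auto intro!: integrable_mult_indicator integrable_real_mult_indicator simp: mult.commute)
    finally show ?thesis .
  qed
  have eq: "(LBINT x:{t<..}. p x) = (LBINT x:{t<..}. n x)" for t
  proof -
    have "(LBINT x:{t<..}. f x) = (LBINT x:{t<..}. p x - n x)"
      by (rule arg_cong[where f="\<lambda>k. LBINT x:{t<..}. k x"]) (auto simp: p_def n_def fun_eq_iff max_def)
    also have "\<dots> = (LBINT x:{t<..}. p x) - (LBINT x:{t<..}. n x)"
      using int by (intro set_integral_diff) (auto simp: set_integrable_def simp del: real_scaleR_def intro!: integrable_mult_indicator)
    finally show ?thesis using 0 by simp
  qed
  have "density lborel (\<lambda>x. ennreal (p x)) = density lborel (\<lambda>x. ennreal (n x))"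
    by (rule measure_eqI_lessThan) (auto simp: em int nn eq)
  moreover have "(\<integral>\<^sup>+x. ennreal (p x) \<partial>lborel) \<noteq> \<infinity>"
    using int(1) nn by (subst nn_integral_eq_integral) auto
  ultimately have "AE x in lborel. ennreal (p x) = ennreal (n x)"
    by (subst (asm) finite_density_unique) auto
  then show ?thesis
    by eventually_elim (use nn in \<open>auto simp: p_def n_def max_def split: if_splits\<close>)
qed

text \<open>Reduction to \<open>AE_eq_0_if_integral_Ioi_0\<close>: extend \<open>f\<close> by zero and replace it by a
  Borel function that is equal to it almost everywhere.\<close>
lemma AE_eq_0_if_indefinite_integral_0:
  fixes f :: "real \<Rightarrow> real"
  assumes f: "f absolutely_integrable_on {\<alpha>..\<beta>}"
    and 0: "\<And>x. x \<in> {\<alpha>..\<beta>} \<Longrightarrow> integral {\<alpha>..x} f = 0"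
  shows "AE x in lebesgue_on {\<alpha><..<\<beta>}. f x = 0"
proof (cases "\<alpha> \<le> \<beta>")
  case True
  define k where "k = (\<lambda>x. indicator {\<alpha>..\<beta>} x * f x)"
  have k: "integrable lebesgue k" using f by (simp add: k_def set_integrable_def)
  then obtain l where l[measurable]: "l \<in> borel_measurable lborel" and AE: "AE x in lborel. k x = l x"
    using completion_ex_borel_measurable_real[of k lborel] by auto
  have AE': "AE x in lebesgue. k x = l x" using AE by (rule AE_completion)
  have lleb: "integrable lebesgue l"
    using k AE' by (subst integrable_cong_AE[of l _ k]) (auto intro: measurable_completion)
  then have lint: "integrable lborel l" by (subst (asm) integrable_completion) auto
  have "(LBINT x:{t<..}. l x) = 0" for t
  proof -
    have kint: "set_integrable lebesgue {t<..} k"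
      unfolding set_integrable_def by (rule integrable_mult_indicator[OF _ k]) simp
    have "(LBINT x:{t<..}. l x) = (LINT x:{t<..}|lebesgue. l x)"
      unfolding set_lebesgue_integral_def by (rule integral_completion[symmetric]) auto
    also have "\<dots> = (LINT x:{t<..}|lebesgue. k x)"
      unfolding set_lebesgue_integral_def
      using AE' by (intro integral_cong_AE borel_measurable_integrable integrable_mult_indicator k lleb) auto
    also have "\<dots> = integral {t<..} k"
      by (rule set_lebesgue_integral_eq_integral(2)[OF kint])
    also have "\<dots> = integral {t<..} (\<lambda>x. if x \<in> {\<alpha>..\<beta>} then f x else 0)"
      by (rule arg_cong[where f="integral _"]) (auto simp: k_def fun_eq_iff)
    also have "\<dots> = integral ({\<alpha>..\<beta>} \<inter> {t<..}) f" by (rule integral_restrict_Int)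
    also have "\<dots> = 0"
    proof -
      consider "t < \<alpha>" | "\<beta> \<le> t" | "t \<in> {\<alpha>..\<beta>}" by force
      then show ?thesis
      proof cases
        case 1
        then have "{\<alpha>..\<beta>} \<inter> {t<..} = {\<alpha>..\<beta>}" by auto
        then show ?thesis using 0[of \<beta>] True by simp
      next
        case 2
        then have "{\<alpha>..\<beta>} \<inter> {t<..} = {}" by auto
        then show ?thesis by simp
      next
        case 3
        then have e: "{\<alpha>..\<beta>} \<inter> {t<..} = {t<..\<beta>}" by auto
        have open_end: "integral {t<..\<beta>} f = integral {t..\<beta>} f"
          by (rule integral_subset_negligible) (auto intro: negligible_subset[of "{t}"])
        have "f integrable_on {\<alpha>..\<beta>}" using f by (simp add: set_lebesgue_integral_eq_integral)
        then have "integral {\<alpha>..t} f + integral {t..\<beta>} f = integral {\<alpha>..\<beta>} f"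
          using 3 by (intro Henstock_Kurzweil_Integration.integral_combine) auto
        then show ?thesis using 0[of t] 0[of \<beta>] 3 True by (simp add: e open_end)
      qed
    qed
    finally show ?thesis .
  qed
  then have "AE x in lborel. l x = 0" by (rule AE_eq_0_if_integral_Ioi_0[OF lint])
  then have "AE x in lebesgue. l x = 0" by (rule AE_completion)
  with AE' have "AE x in lebesgue. x \<in> {\<alpha><..<\<beta>} \<longrightarrow> f x = 0"
    by eventually_elim (auto simp: k_def)
  then show ?thesis by (simp add: AE_restrict_space_iff)
qed auto

section \<open>Indefinite Lebesgue integrals\<close>

text \<open>\<open>F\<close> is absolutely continuous on \<open>[\<alpha>, \<beta>]\<close> with derivative \<open>f\<close>. The increment of \<open>F\<close>
  stands on the right, so that the equation can serve as a rewrite rule.\<close>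
definition ac_primitive :: "real \<Rightarrow> real \<Rightarrow> (real \<Rightarrow> real) \<Rightarrow> (real \<Rightarrow> real) \<Rightarrow> bool" where
  "ac_primitive \<alpha> \<beta> F f \<longleftrightarrow> f absolutely_integrable_on {\<alpha>..\<beta>} \<and>
     (\<forall>x\<in>{\<alpha>..\<beta>}. integral {\<alpha>..x} f = F x - F \<alpha>)"

lemma ac_primitive_continuous:
  assumes "ac_primitive \<alpha> \<beta> F f" shows "continuous_on {\<alpha>..\<beta>} F"
proof -
  have "continuous_on {\<alpha>..\<beta>} (\<lambda>x. F \<alpha> + integral {\<alpha>..x} f)"
    using assms unfolding ac_primitive_def
    by (intro continuous_intros indefinite_integral_continuous_1) (simp add: set_lebesgue_integral_eq_integral)
  then show ?thesis
    by (rule continuous_on_eq) (use assms in \<open>auto simp: ac_primitive_def\<close>)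
qed

lemma ac_primitive_integral:
  assumes "ac_primitive \<alpha> \<beta> F f" "\<alpha> \<le> \<beta>"
  shows "integral {\<alpha>..\<beta>} f = F \<beta> - F \<alpha>"
  using assms by (auto simp: ac_primitive_def)

lemma ac_primitive_of_deriv:
  assumes "\<And>x. x \<in> {\<alpha>..\<beta>} \<Longrightarrow> (F has_real_derivative f x) (at x within {\<alpha>..\<beta>})"
    and "continuous_on {\<alpha>..\<beta>} f"
  shows "ac_primitive \<alpha> \<beta> F f"
  unfolding ac_primitive_def
proof (intro conjI ballI)
  show "f absolutely_integrable_on {\<alpha>..\<beta>}"
    using assms(2) by (rule absolutely_integrable_continuous_real)
  fix x assume x: "x \<in> {\<alpha>..\<beta>}"
  then have "(f has_integral F x - F \<alpha>) {\<alpha>..x}"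
    by (intro fundamental_theorem_of_calculus)
      (auto simp: has_real_derivative_iff_has_vector_derivative[symmetric] intro!: DERIV_subset[OF assms(1)])
  then show "integral {\<alpha>..x} f = F x - F \<alpha>" by (simp add: integral_unique)
qed

lemma ac_primitive_mult:
  assumes F: "ac_primitive \<alpha> \<beta> F f" and G: "ac_primitive \<alpha> \<beta> G g"
  shows "ac_primitive \<alpha> \<beta> (\<lambda>x. F x * G x) (\<lambda>x. G x * f x + F x * g x)"
proof -
  have abs: "f absolutely_integrable_on {\<alpha>..\<beta>}" "g absolutely_integrable_on {\<alpha>..\<beta>}"
    using F G by (auto simp: ac_primitive_def)
  have int: "(\<lambda>y. G y * f y + F y * g y) absolutely_integrable_on {\<alpha>..\<beta>}"
    by (intro set_integral_add(1) absolutely_integrable_continuous_mult ac_primitive_continuous[OF F] ac_primitive_continuous[OF G] abs)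
  moreover have "integral {\<alpha>..x} (\<lambda>y. G y * f y + F y * g y) = F x * G x - F \<alpha> * G \<alpha>"
    if x: "x \<in> {\<alpha>..\<beta>}" for x
  proof -
    define F0 G0 where "F0 = (\<lambda>x. integral {\<alpha>..x} f)" and "G0 = (\<lambda>x. integral {\<alpha>..x} g)"
    have FG: "F y = F \<alpha> + F0 y" "G y = G \<alpha> + G0 y" if "y \<in> {\<alpha>..\<beta>}" for y
      using F G that by (auto simp: ac_primitive_def F0_def G0_def)
    have ax: "f absolutely_integrable_on {\<alpha>..x}" "g absolutely_integrable_on {\<alpha>..x}"
      using x by (auto intro!: abs[THEN absolutely_integrable_on_subinterval])
    note ix = set_lebesgue_integral_eq_integral(1)[OF ax(1)] set_lebesgue_integral_eq_integral(1)[OF ax(2)]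
    have "continuous_on {\<alpha>..x} F0" "continuous_on {\<alpha>..x} G0"
      unfolding F0_def G0_def using ix by (auto intro: indefinite_integral_continuous_1)
    then have i0: "(\<lambda>y. G0 y * f y) integrable_on {\<alpha>..x}" "(\<lambda>y. F0 y * g y) integrable_on {\<alpha>..x}"
      using ax by (auto intro!: set_lebesgue_integral_eq_integral(1) absolutely_integrable_continuous_mult)
    have "integral {\<alpha>..x} (\<lambda>y. G y * f y + F y * g y)
        = integral {\<alpha>..x} (\<lambda>y. (G0 y * f y + F0 y * g y) + (G \<alpha> * f y + F \<alpha> * g y))"
    proof (rule integral_cong)
      fix y assume "y \<in> {\<alpha>..x}"
      then have y: "y \<in> {\<alpha>..\<beta>}" using x by simp
      show "G y * f y + F y * g y = (G0 y * f y + F0 y * g y) + (G \<alpha> * f y + F \<alpha> * g y)"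
        by (subst FG(1)[OF y], subst FG(2)[OF y]) (simp add: algebra_simps)
    qed
    also have "\<dots> = integral {\<alpha>..x} (\<lambda>y. G0 y * f y + F0 y * g y) + (G \<alpha> * F0 x + F \<alpha> * G0 x)"
      using i0 ix by (simp add: integral_add integrable_add integrable_on_mult_right F0_def G0_def)
    also have "integral {\<alpha>..x} (\<lambda>y. G0 y * f y + F0 y * g y) = F0 x * G0 x"
      unfolding F0_def G0_def by (rule integral_mult_triangle[OF ax])
    finally show ?thesis using FG[OF x] by (simp add: algebra_simps)
  qed
  ultimately show ?thesis by (simp add: ac_primitive_def)
qed

lemma ac_primitive_AE_unique:
  assumes F: "ac_primitive \<alpha> \<beta> F f" and G: "ac_primitive \<alpha> \<beta> F g"
  shows "AE x in lebesgue_on {\<alpha><..<\<beta>}. f x = g x"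
proof -
  have abs: "f absolutely_integrable_on {\<alpha>..\<beta>}" "g absolutely_integrable_on {\<alpha>..\<beta>}"
    using F G by (auto simp: ac_primitive_def)
  have "integral {\<alpha>..x} (\<lambda>y. f y - g y) = 0" if x: "x \<in> {\<alpha>..\<beta>}" for x
  proof -
    have "f absolutely_integrable_on {\<alpha>..x}" "g absolutely_integrable_on {\<alpha>..x}"
      using x by (auto intro!: abs[THEN absolutely_integrable_on_subinterval])
    then have "integral {\<alpha>..x} (\<lambda>y. f y - g y) = integral {\<alpha>..x} f - integral {\<alpha>..x} g"
      by (intro integral_diff) (auto simp: set_lebesgue_integral_eq_integral)
    also have "\<dots> = 0" using F G x by (simp add: ac_primitive_def)
    finally show ?thesis .
  qed
  then have "AE x in lebesgue_on {\<alpha><..<\<beta>}. f x - g x = 0"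
    using abs by (intro AE_eq_0_if_indefinite_integral_0 set_integral_diff(1))
  then show ?thesis by simp
qed

section \<open>Weak derivatives of absolutely continuous functions\<close>

lemma test_fun_on_props:
  assumes "test_fun_on S \<psi>"
  shows "continuous_on T (deriv \<psi>)" and "(\<psi> has_real_derivative deriv \<psi> x) (at x within T)"
    and "x \<notin> S \<Longrightarrow> \<psi> x = 0"
proof -
  obtain D where D: "\<And>x. (\<psi> has_vector_derivative D x) (at x)" "continuous_on UNIV D"
    using assms unfolding test_fun_on_def C1_differentiable_on_def by auto
  then have D': "(\<psi> has_real_derivative D x) (at x)" for x
    by (simp add: has_real_derivative_iff_has_vector_derivative)
  then have "deriv \<psi> = D" by (auto intro: DERIV_imp_deriv)
  then show "continuous_on T (deriv \<psi>)" "(\<psi> has_real_derivative deriv \<psi> x) (at x within T)"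
    using continuous_on_subset[OF D(2)] has_field_derivative_at_within[OF D'] by auto
  have "{x. \<psi> x \<noteq> 0} \<subseteq> S"
    using assms closure_subset[of "{x. \<psi> x \<noteq> 0}"] unfolding test_fun_on_def by (meson order_trans)
  then show "x \<notin> S \<Longrightarrow> \<psi> x = 0" by auto
qed

text \<open>The product rule for \<open>F \<psi>\<close>, which vanishes at both endpoints.\<close>
lemma ac_primitive_integrate_test_fun:
  assumes F: "ac_primitive \<alpha> \<beta> F f" and "\<alpha> \<le> \<beta>" and \<psi>: "test_fun_on {\<alpha><..<\<beta>} \<psi>"
  shows "integral\<^sup>L (lebesgue_on {\<alpha><..<\<beta>}) (\<lambda>x. F x * deriv \<psi> x)
    = - integral\<^sup>L (lebesgue_on {\<alpha><..<\<beta>}) (\<lambda>x. f x * \<psi> x)"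
proof -
  note t = test_fun_on_props[OF \<psi>]
  have P: "ac_primitive \<alpha> \<beta> \<psi> (deriv \<psi>)"
    by (intro ac_primitive_of_deriv t)
  have f: "f absolutely_integrable_on {\<alpha>..\<beta>}" using F by (simp add: ac_primitive_def)
  have a1: "(\<lambda>x. \<psi> x * f x) absolutely_integrable_on {\<alpha>..\<beta>}"
    by (rule absolutely_integrable_continuous_mult[OF ac_primitive_continuous[OF P] f])
  have a2: "(\<lambda>x. F x * deriv \<psi> x) absolutely_integrable_on {\<alpha>..\<beta>}"
    by (intro absolutely_integrable_continuous_real continuous_intros ac_primitive_continuous[OF F] t)
  have "integral {\<alpha>..\<beta>} (\<lambda>x. \<psi> x * f x + F x * deriv \<psi> x) = F \<beta> * \<psi> \<beta> - F \<alpha> * \<psi> \<alpha>"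
    by (rule ac_primitive_integral[OF ac_primitive_mult[OF F P] \<open>\<alpha> \<le> \<beta>\<close>])
  also have "\<dots> = 0" using t(3) by simp
  finally have "integral {\<alpha>..\<beta>} (\<lambda>x. \<psi> x * f x) + integral {\<alpha>..\<beta>} (\<lambda>x. F x * deriv \<psi> x) = 0"
    using a1 a2 by (simp add: integral_add set_lebesgue_integral_eq_integral(1))
  then show ?thesis
    using integral_lebesgue_on_Ioo(2)[OF a1] integral_lebesgue_on_Ioo(2)[OF a2] by (simp add: mult.commute)
qed

text \<open>On \<open>[c, d]\<close> inside the open interval take a bump \<open>q > 0\<close> on \<open>(c, d)\<close> that vanishes
  elsewhere, and let \<open>m\<close> be the \<open>q\<close>-weighted mean of \<open>H\<close>. Then \<open>q (H - m)\<close> has integral zero,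
  so its antiderivative \<open>\<psi>\<close> is a test function, and testing with it makes the
  integral of \<open>q (H - m)\<^sup>2\<close> vanish. Hence \<open>H = m\<close> on \<open>(c, d)\<close>, and
  any two points of the open interval lie in such a \<open>(c, d)\<close>; the endpoints follow by continuity.\<close>
lemma du_Bois_Reymond:
  assumes H: "continuous_on {\<alpha>..\<beta>} H"
    and test: "\<And>\<psi>. test_fun_on {\<alpha><..<\<beta>} \<psi> \<Longrightarrow> integral\<^sup>L (lebesgue_on {\<alpha><..<\<beta>}) (\<lambda>x. H x * deriv \<psi> x) = 0"
    and x: "x \<in> {\<alpha>..\<beta>}"
  shows "H x = H \<alpha>"
proof -
  have const: "\<exists>m. \<forall>x\<in>{c<..<d}. H x = m" if cd: "\<alpha> < c" "c < d" "d < \<beta>" for c d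
  proof -
    \<comment> \<open>The continuous extension of \<open>H\<close> to the line, constant outside \<open>[\<alpha>, \<beta>]\<close>.\<close>
    define E where "E = (\<lambda>x. H (max \<alpha> (min \<beta> x)))"
    have HE: "x \<in> {\<alpha>..\<beta>} \<Longrightarrow> H x = E x" for x by (simp add: E_def)
    have contE: "continuous_on S E" for S
      unfolding E_def by (rule continuous_on_compose2[OF H]) (use cd in \<open>auto intro!: continuous_intros\<close>)
    define q where "q = (\<lambda>x. max 0 ((x - c) * (d - x)))"
    have contq: "continuous_on S q" for S unfolding q_def by (intro continuous_intros)
    have q0: "q x = 0" if "x \<notin> {c<..<d}" for x
    proof -
      have "(x - c) * (d - x) \<le> 0"
        using that cd by (cases "x \<le> c") (auto intro: mult_nonpos_nonneg mult_nonneg_nonpos)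
      then show ?thesis by (simp add: q_def)
    qed
    have qpos: "q x > 0" if "x \<in> {c<..<d}" for x using that by (simp add: q_def less_max_iff_disj)
    have "q ((c + d) / 2) \<noteq> 0" using qpos[of "(c + d) / 2"] cd by simp
    then have qint: "integral {c..d} q \<noteq> 0"
      using cd by (subst integral_eq_0_iff[OF contq]) (auto simp: q_def intro!: bexI[of _ "(c + d) / 2"])
    define m where "m = integral {c..d} (\<lambda>x. q x * E x) / integral {c..d} q"
    define w where "w = (\<lambda>x. q x * (E x - m))"
    have contw: "continuous_on S w" for S unfolding w_def by (intro continuous_intros contE contq)
    have w0: "w x = 0" if "x \<notin> {c<..<d}" for x using q0[OF that] by (simp add: w_def)
    have "integral {c..d} w = integral {c..d} (\<lambda>x. q x * E x) - integral {c..d} (\<lambda>x. m * q x)"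
      unfolding w_def
      by (subst integral_diff[symmetric])
        (auto intro!: integrable_continuous_real continuous_intros contE contq simp: algebra_simps)
    also have "\<dots> = 0" using qint by (simp add: m_def)
    finally have wint: "integral {c..d} w = 0" .
    have "\<exists>F. \<forall>x::real. -\<infinity> < ereal x \<longrightarrow> ereal x < \<infinity> \<longrightarrow> (F has_vector_derivative w x) (at x)"
      using contw[of UNIV] by (intro einterval_antiderivative) (auto simp: continuous_on_eq_continuous_at)
    then obtain F where F: "\<And>x. (F has_real_derivative w x) (at x)"
      by (auto simp: has_real_derivative_iff_has_vector_derivative)
    define \<psi> where "\<psi> = (\<lambda>x. F x - F c)"
    have \<psi>': "(\<psi> has_real_derivative w x) (at x)" for x
      unfolding \<psi>_def using F[of x] by (auto intro!: derivative_eq_intros)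
    then have d\<psi>: "deriv \<psi> = w" by (auto intro: DERIV_imp_deriv)
    have flat: "F u = F v" if "u \<le> v" "\<And>x. x \<in> {u..v} \<Longrightarrow> w x = 0" for u v
    proof (cases "u < v")
      case True
      have "F v = F u"
      proof (rule DERIV_isconst_end[OF True])
        show "continuous_on {u..v} F"
          using F by (intro continuous_at_imp_continuous_on ballI DERIV_isCont)
        show "(F has_real_derivative 0) (at x)" if "u < x" "x < v" for x
          using F[of x] \<open>\<And>x. x \<in> {u..v} \<Longrightarrow> w x = 0\<close>[of x] that by simp
      qed
      then show ?thesis by simp
    qed (use that in auto)
    have Fd: "F d = F c"
    proof -
      have "(w has_integral F d - F c) {c..d}"
        using cd F by (intro fundamental_theorem_of_calculus)
          (auto simp: has_real_derivative_iff_has_vector_derivative[symmetric] intro: has_field_derivative_at_within)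
      then show ?thesis using wint by (simp add: integral_unique)
    qed
    have "\<psi> x = 0" if "x \<notin> {c..d}" for x
    proof (cases "x < c")
      case True
      then have "F x = F c" by (intro flat w0) auto
      then show ?thesis by (simp add: \<psi>_def)
    next
      case False
      then have "F d = F x" using that by (intro flat w0) auto
      then show ?thesis using Fd by (simp add: \<psi>_def)
    qed
    then have "{x. \<psi> x \<noteq> 0} \<subseteq> {c..d}" by blast
    then have supp: "closure {x. \<psi> x \<noteq> 0} \<subseteq> {c..d}" by (simp add: closure_minimal)
    have "test_fun_on {\<alpha><..<\<beta>} \<psi>"
      unfolding test_fun_on_def C1_differentiable_on_def
    proof (intro conjI exI ballI)
      show "(\<psi> has_vector_derivative w x) (at x)" for x
        using \<psi>' by (simp add: has_real_derivative_iff_has_vector_derivative)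
      show "continuous_on UNIV w" by (rule contw)
      show "compact (closure {x. \<psi> x \<noteq> 0})"
        using supp by (meson bounded_closed_interval bounded_subset closed_closure compact_eq_bounded_closed)
      show "closure {x. \<psi> x \<noteq> 0} \<subseteq> {\<alpha><..<\<beta>}" using supp cd by fastforce
    qed
    then have "0 = integral\<^sup>L (lebesgue_on {\<alpha><..<\<beta>}) (\<lambda>x. H x * w x)"
      using test[of \<psi>] d\<psi> by simp
    also have "\<dots> = integral {\<alpha>..\<beta>} (\<lambda>x. H x * w x)"
      by (intro integral_lebesgue_on_Ioo absolutely_integrable_continuous_real continuous_intros H contw)
    also have "\<dots> = integral {\<alpha>..\<beta>} (\<lambda>x. E x * w x)"
      by (intro integral_cong) (simp add: HE)
    also have "\<dots> = integral {\<alpha>..\<beta>} (\<lambda>x. if x \<in> {c..d} then E x * w x else 0)"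
      by (intro integral_cong) (use w0 in auto)
    also have "\<dots> = integral {c..d} (\<lambda>x. E x * w x)"
      using cd by (simp add: integral_restrict_Int Int_absorb2 flip: atLeastAtMost_iff)
    also have "\<dots> = integral {c..d} (\<lambda>x. E x * w x) - m * integral {c..d} w" by (simp add: wint)
    also have "\<dots> = integral {c..d} (\<lambda>x. E x * w x - m * w x)"
      by (subst integral_diff)
        (auto intro!: integrable_continuous_real continuous_intros contE contw)
    also have "\<dots> = integral {c..d} (\<lambda>x. q x * (E x - m)\<^sup>2)"
      by (simp add: w_def power2_eq_square algebra_simps)
    \<comment> \<open>A continuous nonnegative function with integral zero vanishes.\<close>
    finally have zero: "\<forall>x\<in>{c..d}. q x * (E x - m)\<^sup>2 = 0"
      using cd by (subst (asm) eq_commute, subst (asm) integral_eq_0_iff)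
        (auto intro!: continuous_intros contq contE simp: q_def)
    then have "E x = m" if "x \<in> {c<..<d}" for x
      using bspec[OF zero, of x] that qpos[OF that] by simp
    then have "\<forall>x\<in>{c<..<d}. H x = m" using HE cd by simp
    then show ?thesis ..
  qed
  have eq: "H y = H z" if yz: "y \<in> {\<alpha><..<\<beta>}" "z \<in> {\<alpha><..<\<beta>}" for y z
  proof -
    define c d where "c = (\<alpha> + min y z) / 2" and "d = (max y z + \<beta>) / 2"
    have "\<alpha> < c" "c < y" "c < z" "y < d" "z < d" "d < \<beta>" 
      using yz by (auto simp: c_def d_def min_def max_def field_simps)
    then obtain m where "\<forall>x\<in>{c<..<d}. H x = m" using const[of c d] by fastforce
    then show ?thesis using \<open>c < y\<close> \<open>c < z\<close> \<open>y < d\<close> \<open>z < d\<close> by simp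
  qed
  show ?thesis
  proof (cases "\<alpha> < \<beta>")
    case True
    define y where "y = (\<alpha> + \<beta>) / 2"
    have y: "y \<in> {\<alpha><..<\<beta>}" using True by (simp add: y_def)
    have "H x = H y" if "x \<in> {\<alpha>..\<beta>}" for x
    proof (rule continuous_constant_on_closure[of "{\<alpha><..<\<beta>}" H "H y" x])
      show "continuous_on (closure {\<alpha><..<\<beta>}) H" "x \<in> closure {\<alpha><..<\<beta>}"
        using True H that by (simp_all add: closure_greaterThanLessThan)
    qed (rule eq[OF _ y])
    from this[of x] this[of \<alpha>] show ?thesis using x by simp
  next
    case False
    then have "x = \<alpha>" using x by simp
    then show ?thesis by simp
  qed
qed

text \<open>The interval is bounded and \<open>\<bar>g\<bar> \<le> 1 + g\<^sup>2\<close>.\<close>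
lemma L2_on_imp_absolutely_integrable:
  assumes "L2_on {\<alpha><..<\<beta>} g"
  shows "g absolutely_integrable_on {\<alpha>..\<beta>}"
proof -
  have sq: "integrable (lebesgue_on {\<alpha><..<\<beta>}) (\<lambda>x. (g x)\<^sup>2)" and [measurable]: "g \<in> borel_measurable (lebesgue_on {\<alpha><..<\<beta>})"
    using assms by (auto simp: L2_on_def)
  interpret finite_measure "lebesgue_on {\<alpha><..<\<beta>}"
    by (rule finite_measure_lebesgue_on) auto
  have "integrable (lebesgue_on {\<alpha><..<\<beta>}) (\<lambda>x. 1 + (g x)\<^sup>2)"
    using sq by simp
  then have "integrable (lebesgue_on {\<alpha><..<\<beta>}) g"
  proof (rule Bochner_Integration.integrable_bound)
    have "\<bar>g x\<bar> \<le> 1 + (g x)\<^sup>2" for x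
      using sum_squares_ge_zero[of 0 "\<bar>g x\<bar> - 1"] zero_le_power2[of "\<bar>g x\<bar> - 1"] by (simp add: power2_diff) 
    then show "AE x in lebesgue_on {\<alpha><..<\<beta>}. norm (g x) \<le> norm (1 + (g x)\<^sup>2)"
      by (auto intro: order_trans)
  qed simp
  then have "g absolutely_integrable_on {\<alpha><..<\<beta>}" by (simp add: absolutely_integrable_on_iff_integrable)
  then show ?thesis using absolutely_integrable_on_Icc_iff_Ioo by blast
qed

text \<open>The difference of \<open>h\<close> and an indefinite integral of \<open>g\<close> is continuous and has weak
  derivative zero, so it is constant by \<open>du_Bois_Reymond\<close>.\<close>
lemma L2_weak_deriv_on_imp_ac_primitive:
  assumes h: "continuous_on {\<alpha>..\<beta>} h" and g: "L2_weak_deriv_on {\<alpha><..<\<beta>} h g" and "\<alpha> \<le> \<beta>"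
  shows "ac_primitive \<alpha> \<beta> h g"
proof -
  have abs: "g absolutely_integrable_on {\<alpha>..\<beta>}"
    using g by (auto simp: L2_weak_deriv_on_def L2_on_imp_absolutely_integrable)
  define G where "G = (\<lambda>x. integral {\<alpha>..x} g)"
  have G: "ac_primitive \<alpha> \<beta> G g" using abs by (simp add: ac_primitive_def G_def)
  have "h x - G x = h \<alpha> - G \<alpha>" if x: "x \<in> {\<alpha>..\<beta>}" for x
  proof (rule du_Bois_Reymond[OF _ _ x])
    show "continuous_on {\<alpha>..\<beta>} (\<lambda>x. h x - G x)"
      by (intro continuous_intros h ac_primitive_continuous[OF G])
    fix \<psi> assume \<psi>: "test_fun_on {\<alpha><..<\<beta>} \<psi>"
    have int: "integrable (lebesgue_on {\<alpha><..<\<beta>}) (\<lambda>x. k x * deriv \<psi> x)" if "continuous_on {\<alpha>..\<beta>} k" for k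
      by (intro integral_lebesgue_on_Ioo absolutely_integrable_continuous_real continuous_intros that test_fun_on_props[OF \<psi>])
    have "integral\<^sup>L (lebesgue_on {\<alpha><..<\<beta>}) (\<lambda>x. (h x - G x) * deriv \<psi> x)
        = integral\<^sup>L (lebesgue_on {\<alpha><..<\<beta>}) (\<lambda>x. h x * deriv \<psi> x) - integral\<^sup>L (lebesgue_on {\<alpha><..<\<beta>}) (\<lambda>x. G x * deriv \<psi> x)"
      using int[OF h] int[OF ac_primitive_continuous[OF G]] by (simp add: left_diff_distrib)
    also have "\<dots> = 0"
      using g \<psi> ac_primitive_integrate_test_fun[OF G \<open>\<alpha> \<le> \<beta>\<close> \<psi>] by (simp add: L2_weak_deriv_on_def)
    finally show "integral\<^sup>L (lebesgue_on {\<alpha><..<\<beta>}) (\<lambda>x. (h x - G x) * deriv \<psi> x) = 0" .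
  qed
  moreover have "G \<alpha> = 0" by (simp add: G_def)
  ultimately have "G x = h x - h \<alpha>" if "x \<in> {\<alpha>..\<beta>}" for x
    using that by force
  then show ?thesis using abs by (simp add: ac_primitive_def G_def)
qed

lemma ac_primitive_imp_L2_weak_deriv_on:
  assumes "ac_primitive \<alpha> \<beta> F f" "\<alpha> \<le> \<beta>" "L2_on {\<alpha><..<\<beta>} f"
  shows "L2_weak_deriv_on {\<alpha><..<\<beta>} F f"
  using assms ac_primitive_integrate_test_fun by (auto simp: L2_weak_deriv_on_def)

lemma L2_on_continuous_mult:
  assumes c: "continuous_on {\<alpha>..\<beta>} c" and g: "L2_on {\<alpha><..<\<beta>} g"
  shows "L2_on {\<alpha><..<\<beta>} (\<lambda>x. c x * g x)"
proof -
  have "(\<lambda>x. (g x)\<^sup>2) absolutely_integrable_on {\<alpha>..\<beta>}"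
    using g by (simp add: L2_on_def absolutely_integrable_on_iff_integrable absolutely_integrable_on_Icc_iff_Ioo)
  then have "(\<lambda>x. (c x)\<^sup>2 * (g x)\<^sup>2) absolutely_integrable_on {\<alpha>..\<beta>}"
    by (intro absolutely_integrable_continuous_mult continuous_intros c)
  moreover have "c \<in> borel_measurable (lebesgue_on {\<alpha><..<\<beta>})"
    by (rule continuous_imp_measurable_on_sets_lebesgue) (auto intro!: continuous_on_subset[OF c])
  ultimately show ?thesis
    using g by (auto simp: L2_on_def power_mult_distrib integral_lebesgue_on_Ioo(1))
qed

lemma L2_on_add:
  assumes f: "L2_on S f" and g: "L2_on S g"
  shows "L2_on S (\<lambda>x. f x + g x)"
  unfolding L2_on_def
proof
  have [measurable]: "f \<in> borel_measurable (lebesgue_on S)" "g \<in> borel_measurable (lebesgue_on S)"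
    using f g by (auto simp: L2_on_def)
  show "(\<lambda>x. f x + g x) \<in> borel_measurable (lebesgue_on S)" by simp
  have "integrable (lebesgue_on S) (\<lambda>x. 2 * (f x)\<^sup>2 + 2 * (g x)\<^sup>2)"
    using f g by (simp add: L2_on_def)
  then show "integrable (lebesgue_on S) (\<lambda>x. (f x + g x)\<^sup>2)"
  proof (rule Bochner_Integration.integrable_bound)
    have "(f x + g x)\<^sup>2 \<le> 2 * (f x)\<^sup>2 + 2 * (g x)\<^sup>2" for x
      using zero_le_power2[of "f x - g x"] by (simp add: power2_eq_square algebra_simps)
    then show "AE x in lebesgue_on S. norm ((f x + g x)\<^sup>2) \<le> norm (2 * (f x)\<^sup>2 + 2 * (g x)\<^sup>2)"
      by simp
  qed simp
qed

lemma weak_deriv_is_L2_weak_deriv: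
  "L2_weak_deriv_on S f g \<Longrightarrow> L2_weak_deriv_on S f (weak_deriv S f)"
  unfolding weak_deriv_def by (rule someI[of "L2_weak_deriv_on S f"])

lemma weak_deriv_AE_eq:
  assumes F: "ac_primitive \<alpha> \<beta> F f" and f: "L2_on {\<alpha><..<\<beta>} f" and "\<alpha> \<le> \<beta>"
  shows "AE x in lebesgue_on {\<alpha><..<\<beta>}. weak_deriv {\<alpha><..<\<beta>} F x = f x"
proof -
  have "L2_weak_deriv_on {\<alpha><..<\<beta>} F f"
    using assms by (intro ac_primitive_imp_L2_weak_deriv_on)
  then have "L2_weak_deriv_on {\<alpha><..<\<beta>} F (weak_deriv {\<alpha><..<\<beta>} F)"
    by (rule weak_deriv_is_L2_weak_deriv)
  then have "ac_primitive \<alpha> \<beta> F (weak_deriv {\<alpha><..<\<beta>} F)"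
    using assms by (intro L2_weak_deriv_on_imp_ac_primitive ac_primitive_continuous[OF F])
  then show ?thesis using F by (rule ac_primitive_AE_unique)
qed

section \<open>The geometry of the critical catenoid\<close>

lemma cat_base:
  assumes "a > 1/2"
  shows cat_cosh_bound: "a * cosh (2 * s) > 1/2"
    and cat_A_pos: "cat_A a s > 0" and cat_B_pos: "cat_B a s > 0" and cat_K_pos: "cat_K a > 0"
    and cat_A_sq: "(cat_A a s)\<^sup>2 = a * cosh (2 * s) + 1/2"
    and cat_B_sq: "(cat_B a s)\<^sup>2 = a * cosh (2 * s) - 1/2"
    and cat_K_sq: "(cat_K a)\<^sup>2 = a\<^sup>2 - 1/4"
proof -
  have "a * 1 \<le> a * cosh (2 * s)"
    using assms by (intro mult_left_mono) (auto simp: cosh_real_ge_1)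
  then show b: "a * cosh (2 * s) > 1/2" using assms by linarith
  have "(1/2)\<^sup>2 < a\<^sup>2" using assms by (intro power_strict_mono) auto
  then have k: "a\<^sup>2 - 1/4 > 0" by (simp add: power2_eq_square)
  show "cat_A a s > 0" "cat_B a s > 0" "cat_K a > 0"
    "(cat_A a s)\<^sup>2 = a * cosh (2 * s) + 1/2" "(cat_B a s)\<^sup>2 = a * cosh (2 * s) - 1/2" 
    "(cat_K a)\<^sup>2 = a\<^sup>2 - 1/4"
    using b k by (auto simp: cat_A_def cat_B_def cat_K_def)
qed

lemma cat_A_minus_B: "a > 1/2 \<Longrightarrow> (cat_A a s)\<^sup>2 = (cat_B a s)\<^sup>2 + 1"
  by (simp add: cat_A_sq cat_B_sq)

lemma cat_sinh_sq: "a > 1/2 \<Longrightarrow> (a * sinh (2 * s))\<^sup>2 + (cat_K a)\<^sup>2 = (cat_A a s)\<^sup>2 * (cat_B a s)\<^sup>2"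
  by (simp add: cat_A_sq cat_B_sq cat_K_sq power_mult_distrib sinh_square_eq) (simp add: field_simps power2_eq_square)

lemma cat_B_even [simp]: "cat_B a (-s) = cat_B a s"
  by (simp add: cat_B_def)

lemma cat_B_deriv:
  assumes "a > 1/2"
  shows "(cat_B a has_real_derivative a * sinh (2 * s) / cat_B a s) (at s within S)"
proof -
  have "((\<lambda>s. sqrt (a * cosh (2 * s) - 1/2)) has_real_derivative a * sinh (2 * s) / sqrt (a * cosh (2 * s) - 1/2)) (at s within S)"
    using cat_cosh_bound[OF assms, of s]
    by (auto intro!: derivative_eq_intros simp: field_simps)
  then show ?thesis by (simp add: cat_B_def[abs_def])
qed

lemma cat_B_continuous: "a > 1/2 \<Longrightarrow> continuous_on S (cat_B a)"
  by (meson DERIV_continuous_on cat_B_deriv)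

lemma cat_phi_deriv:
  assumes "a > 1/2"
  shows "(cat_phi a has_real_derivative cat_K a / ((cat_A a s)\<^sup>2 * cat_B a s)) (at s)"
proof -
  let ?f = "\<lambda>t. cat_K a / ((cat_A a t)\<^sup>2 * cat_B a t)"
  have "cat_A a t \<noteq> 0" "cat_B a t \<noteq> 0" for t
    using cat_A_pos[OF assms, of t] cat_B_pos[OF assms, of t] by auto
  moreover have "continuous_on UNIV (cat_A a)"
    unfolding cat_A_def[abs_def] by (intro continuous_intros)
  ultimately have "continuous_on UNIV ?f"
    by (intro continuous_intros cat_B_continuous assms) auto
  then have "continuous_on {-\<bar>s\<bar>-1..\<bar>s\<bar>+1} ?f"
    by (rule continuous_on_subset) auto
  then have "((\<lambda>u. LBINT t=ereal 0..u. ?f t) has_vector_derivative ?f s) (at s within {-\<bar>s\<bar>-1..\<bar>s\<bar>+1})"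
    by (intro interval_integral_FTC2) auto
  moreover have "at s within {-\<bar>s\<bar>-1..\<bar>s\<bar>+1} = at s"
    by (rule at_within_interior) auto
  ultimately show ?thesis
    by (simp add: cat_phi_def[abs_def] has_real_derivative_iff_has_vector_derivative zero_ereal_def)
qed

lemma cat_phi_strict_mono: 
  assumes "a > 1/2" "s < t" shows "cat_phi a s < cat_phi a t"
  using assms(2)
  by (rule DERIV_pos_imp_increasing)
    (metis assms(1) cat_phi_deriv cat_A_pos cat_B_pos cat_K_pos divide_pos_pos mult_pos_pos zero_less_power)

lemma cat_phi_0 [simp]: "cat_phi a 0 = 0"
  by (simp add: cat_phi_def zero_ereal_def[symmetric])

text \<open>With \<open>x = cosh(2s)\<close> and \<open>y = cosh(2t)\<close>, the squared inequality says that
  \<open>(a x - 1/2) / (x\<^sup>2 - 1)\<close> decreases in \<open>x\<close>. After clearing denominators, the difference of the two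
  sides has the factors \<open>y - x > 0\<close> and
  \<open>a (x y + 1) - (x + y) / 2 > (x - 1) (y - 1) / 2 > 0\<close>.\<close>
lemma cat_B_over_sinh_strict_antimono:
  assumes "a > 1/2" "0 < s" "s < t"
  shows "cat_B a t / (a * sinh (2 * t)) < cat_B a s / (a * sinh (2 * s))"
proof -
  have pos: "sinh (2 * s) > 0" "sinh (2 * t) > 0" "a > 0" using assms by auto
  define x y where "x = cosh (2 * s)" and "y = cosh (2 * t)"
  have x: "1 < x" "x < y" 
    unfolding x_def y_def using assms cosh_real_strict_mono[of 0 "2 * s"] cosh_real_strict_mono[of "2 * s" "2 * t"] by auto
  have "0 < (x-1) * (y-1)" using x by simp
  also have "\<dots> = 2 * ((1/2) * (x * y+1)) - x - y" by (simp add: algebra_simps)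
  also have "\<dots> < 2 * (a * (x * y+1)) - x - y"
  proof -
    have "x * y+1 > 0" using x by (smt (verit) mult_pos_pos)
    then have "(1/2) * (x * y+1) < a * (x * y+1)" using assms by (intro mult_strict_right_mono) auto
    then show ?thesis by simp
  qed
  finally have "0 < (y - x) * (2 * (a * (x * y+1)) - x - y)" using x by simp
  then have main: "(a * y-1/2) * (x\<^sup>2-1) < (a * x-1/2) * (y\<^sup>2-1)"
    by (simp add: field_simps power2_eq_square)
  have "(cat_B a t * sinh (2 * s))\<^sup>2 < (cat_B a s * sinh (2 * t))\<^sup>2"
    using main by (simp add: power_mult_distrib cat_B_sq[OF assms(1)] sinh_square_eq x_def y_def)
  then have "cat_B a t * sinh (2 * s) < cat_B a s * sinh (2 * t)"
    by (rule power_less_imp_less_base) (use pos cat_B_pos[OF assms(1), of s] in auto)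
  then show ?thesis using pos by (simp add: divide_simps mult.commute mult.left_commute)
qed

text \<open>Multiplied by \<open>a sinh(2s)\<close>, the difference of the two sides is negative at \<open>0\<close>. It becomes
  nonnegative later, since for \<open>s \<ge> 1\<close> the factor \<open>tanh \<phi>(s)\<close> is at least \<open>tanh \<phi>(1) > 0\<close> while
  \<open>a sinh(2s)\<close> outgrows \<open>B\<close>.\<close>
lemma cat_s0_exists:
  assumes "a > 1/2"
  shows "\<exists>s>0. tanh (cat_phi a s) = cat_B a s * cat_K a / (a * sinh (2 * s))"
proof -
  let ?f = "\<lambda>s. tanh (cat_phi a s) * (a * sinh (2 * s)) - cat_B a s * cat_K a"
  have cont: "isCont ?f s" for s
    using cat_phi_deriv[OF assms, of s] cat_B_deriv[OF assms, of s UNIV]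
    by (intro continuous_intros) (auto intro: DERIV_isCont)
  define \<tau> where "\<tau> = tanh (cat_phi a 1)"
  have \<tau>: "\<tau> > 0" using cat_phi_strict_mono[OF assms, of 0 1] by (simp add: \<tau>_def)
  have a: "a > 0" and K: "cat_K a > 0" using assms cat_K_pos by auto
  \<comment> \<open>The three bounds on \<open>c = cosh(2s)\<close> give \<open>s \<ge> 1\<close>, \<open>c\<^sup>2 \<le> 2 (c\<^sup>2 - 1)\<close>, and together with this
    \<open>a c K\<^sup>2 \<le> \<tau>\<^sup>2 a\<^sup>2 (c\<^sup>2 - 1)\<close>.\<close>
  define c where "c = max (cosh 2) (max 2 (2 * (cat_K a)\<^sup>2 / (\<tau>\<^sup>2 * a)))"
  define s where "s = arcosh c / 2"
  have c: "cosh 2 \<le> c" "2 \<le> c" "2 * (cat_K a)\<^sup>2 / (\<tau>\<^sup>2 * a) \<le> c" by (auto simp: c_def)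
  have C: "cosh (2 * s) = c" using c by (simp add: s_def)
  have "0 \<le> arcosh c" using c by simp
  then have "2 \<le> 2 * s" using C c(1) by (metis cosh_real_nonneg_le_iff s_def zero_le_numeral mult.commute nonzero_eq_divide_eq zero_neq_numeral times_divide_eq_right)
  then have s: "1 \<le> s" by simp
  have "\<tau> \<le> tanh (cat_phi a s)" using s cat_phi_strict_mono[OF assms, of 1 s] unfolding \<tau>_def
    by (cases "s = 1") auto
  moreover have "cat_B a s * cat_K a \<le> \<tau> * (a * sinh (2 * s))"
  proof (rule power2_le_imp_le)
    have "2 * (cat_K a)\<^sup>2 \<le> c * (\<tau>\<^sup>2 * a)" using c(3) \<tau> a by (simp add: divide_simps split: if_splits)
    then have "2 * (cat_K a)\<^sup>2 * (a * c) \<le> c * (\<tau>\<^sup>2 * a) * (a * c)"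
      using a c by (intro mult_right_mono) auto
    moreover have "2 * 2 \<le> c * c" using c by (intro mult_mono) auto
    then have "c * c \<le> 2 * (c\<^sup>2 - 1)" by (simp add: power2_eq_square)
    then have "c * c*(\<tau>\<^sup>2 * a\<^sup>2) \<le> 2 * (c\<^sup>2-1) * (\<tau>\<^sup>2 * a\<^sup>2)" by (intro mult_right_mono) auto
    ultimately have "(a * c) * (cat_K a)\<^sup>2 \<le> \<tau>\<^sup>2 * a\<^sup>2 * (c\<^sup>2 - 1)" 
      by (simp add: algebra_simps power2_eq_square)
    moreover have "(a * c - 1/2) * (cat_K a)\<^sup>2 \<le> (a * c) * (cat_K a)\<^sup>2" by (intro mult_right_mono) auto
    ultimately show "(cat_B a s * cat_K a)\<^sup>2 \<le> (\<tau> * (a * sinh (2 * s)))\<^sup>2"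
      by (simp add: power_mult_distrib cat_B_sq[OF assms] sinh_square_eq C mult.assoc)
    show "0 \<le> \<tau> * (a * sinh (2 * s))" using \<tau> a s by simp
  qed
  ultimately have "0 \<le> ?f s" using a s
    by (smt (verit) mult_right_mono mult_nonneg_nonneg sinh_real_nonneg_iff)
  moreover have neg: "?f 0 < 0" using K cat_B_pos[OF assms, of 0] by simp
  ultimately obtain t where t: "0 \<le> t" "t \<le> s" "?f t = 0"
    using IVT[of ?f 0 0 s] cont s by force
  then have "t > 0" using neg by (cases "t = 0") auto
  then show ?thesis using t a by (intro exI[of _ t]) (auto simp: field_simps)
qed

text \<open>The left side of the defining equation increases and the right side decreases, so its
  positive solution is unique and the definite description is meaningful.\<close>
lemma cat_s0:
  assumes "a > 1/2"
  shows cat_s0_pos: "cat_s0 a > 0"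
    and cat_s0_eq: "tanh (cat_phi a (cat_s0 a)) = cat_B a (cat_s0 a) * cat_K a / (a * sinh (2 * cat_s0 a))"
proof -
  let ?P = "\<lambda>s. s > 0 \<and> tanh (cat_phi a s) = cat_B a s * cat_K a / (a * sinh (2 * s))"
  have no: False if "?P s" "?P t" "s < t" for s t
  proof -
    have "tanh (cat_phi a s) < tanh (cat_phi a t)" using cat_phi_strict_mono[OF assms that(3)] by simp
    moreover have "cat_B a t * cat_K a / (a * sinh (2 * t)) < cat_B a s * cat_K a / (a * sinh (2 * s))"
      using mult_strict_right_mono[OF cat_B_over_sinh_strict_antimono[OF assms _ that(3)] cat_K_pos[OF assms]] that by simp
    ultimately show False using that by linarith
  qed
  obtain s where s: "?P s" using cat_s0_exists[OF assms] by blast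
  have "?P (cat_s0 a)" unfolding cat_s0_def
    by (rule theI[of ?P, OF s]) (use no s in \<open>meson linorder_neqE_linordered_idom\<close>)
  then show "cat_s0 a > 0" "tanh (cat_phi a (cat_s0 a)) = cat_B a (cat_s0 a) * cat_K a / (a * sinh (2 * cat_s0 a))"
    by auto
qed

text \<open>By \<open>cat_B_deriv\<close> the right side is \<open>B'(s\<^sub>0) / B(s\<^sub>0)\<close>. The equation for \<open>s\<^sub>0\<close>
  expresses \<open>cosh\<^sup>2 \<phi>(s\<^sub>0)\<close>, hence \<open>cosh\<^sup>2 r(a)\<close>, through \<open>A\<close>, \<open>B\<close>, \<open>K\<close> and \<open>a sinh(2s\<^sub>0)\<close>; the
  relations \<open>A\<^sup>2 = B\<^sup>2 + 1\<close> and \<open>(a sinh(2s))\<^sup>2 + K\<^sup>2 = A\<^sup>2 B\<^sup>2\<close> then give the square of the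
  claim.\<close>
lemma coth_cat_r:
  assumes "a > 1/2"
  shows "coth (cat_r a) = a * sinh (2 * cat_s0 a) / (cat_B a (cat_s0 a))\<^sup>2"
proof -
  define s where "s = cat_s0 a"
  define X where "X = cat_A a s * cosh (cat_phi a s)"
  define S where "S = a * sinh (2 * s)"
  note [simp] = s_def[symmetric]
  have s: "s > 0" using cat_s0_pos[OF assms] by simp
  have S: "S > 0" using s assms by (simp add: S_def)
  have B: "cat_B a s > 0" using cat_B_pos[OF assms] .
  have "1 < (cat_A a s)\<^sup>2" using B cat_A_minus_B[OF assms, of s] by simp
  then have A: "1 < cat_A a s" using cat_A_pos[OF assms, of s] by (simp add: power2_eq_square) (smt (verit) mult_left_le)
  have X: "1 < X" using A cosh_real_ge_1[of "cat_phi a s"] unfolding X_def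
    by (smt (verit) mult_left_le_one_le mult_le_cancel_left1)
  have r: "cat_r a = arcosh X" unfolding cat_r_def s_def[symmetric] X_def[symmetric]
    using X by (intro the_equality) (auto simp: arcosh_cosh_real)
  have coshr: "cosh (cat_r a) = X" and rpos: "cat_r a > 0" using X by (auto simp: r)
  \<comment> \<open>Eliminate the hyperbolic functions of \<open>\<phi>\<close> via \<open>1 / cosh\<^sup>2 = 1 - tanh\<^sup>2\<close>.\<close>
  have "X\<^sup>2 * (S\<^sup>2 - (cat_B a s)\<^sup>2 * (cat_K a)\<^sup>2) = (cat_A a s)\<^sup>2 * S\<^sup>2"
  proof -
    have T: "tanh (cat_phi a s) * S = cat_B a s * cat_K a"
      using cat_s0_eq[OF assms] S by (simp add: S_def[symmetric])
    have "sinh (cat_phi a s) * S = cat_B a s * cat_K a * cosh (cat_phi a s)"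
      using T by (simp add: tanh_def field_simps)
    then have "(sinh (cat_phi a s))\<^sup>2 * S\<^sup>2 = (cat_B a s)\<^sup>2 * (cat_K a)\<^sup>2 * (cosh (cat_phi a s))\<^sup>2"
      by (metis power_mult_distrib)
    then have "(cosh (cat_phi a s))\<^sup>2 * (S\<^sup>2 - (cat_B a s)\<^sup>2 * (cat_K a)\<^sup>2) = S\<^sup>2"
      by (simp add: sinh_square_eq algebra_simps)
    then show ?thesis unfolding X_def power_mult_distrib mult.assoc by simp
  qed
  moreover have "S\<^sup>2 - (cat_B a s)\<^sup>2 * (cat_K a)\<^sup>2 = (cat_A a s)\<^sup>2 * (S\<^sup>2 - ((cat_B a s)\<^sup>2)\<^sup>2)"
  proof -
    have K: "(cat_K a)\<^sup>2 = (cat_A a s)\<^sup>2 * (cat_B a s)\<^sup>2 - S\<^sup>2" using cat_sinh_sq[OF assms, of s] by (simp add: S_def)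
    show ?thesis unfolding K cat_A_minus_B[OF assms] by (simp add: algebra_simps power2_eq_square)
  qed
  ultimately have "X\<^sup>2 * (S\<^sup>2 - ((cat_B a s)\<^sup>2)\<^sup>2) = S\<^sup>2" using A by auto
  then have "(X * (cat_B a s)\<^sup>2)\<^sup>2 = (S * sinh (cat_r a))\<^sup>2"
    by (simp add: power_mult_distrib sinh_square_eq coshr algebra_simps)
  then have "X * (cat_B a s)\<^sup>2 = S * sinh (cat_r a)"
    by (rule power2_eq_imp_eq) (use X S rpos in auto)
  then show ?thesis using rpos B by (simp add: coth_def coshr S_def field_simps)
qed

text \<open>Where the logarithmic derivative of \<open>B\<close> is the Robin coefficient, \<open>B h\<close> satisfies the Robin
  equation exactly if \<open>h' = 0\<close>. This holds at \<open>s\<^sub>0\<close> by \<open>coth_cat_r\<close>, and at \<open>- s\<^sub>0\<close> because \<open>sinh\<close>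
  is odd and \<open>B\<close> is even.\<close>
lemma robin_iff_neumann:
  assumes a: "a > 1 / 2"
  shows "robin_cond a (\<lambda>s. cat_B a s * h s) \<longleftrightarrow> neumann_cond a h"
proof -
  have key: "((\<lambda>s. cat_B a s * h s) has_real_derivative (a * sinh (2 * t) / (cat_B a t)\<^sup>2) * (cat_B a t * h t)) (at t within S)
      \<longleftrightarrow> (h has_real_derivative 0) (at t within S)" for t S
  proof
    have B: "cat_B a s \<noteq> 0" for s using cat_B_pos[OF a, of s] by simp
    assume "(h has_real_derivative 0) (at t within S)"
    from DERIV_mult[OF cat_B_deriv[OF a] this]
    show "((\<lambda>s. cat_B a s * h s) has_real_derivative (a * sinh (2 * t) / (cat_B a t)\<^sup>2) * (cat_B a t * h t)) (at t within S)"
      by (rule DERIV_cong) (use B[of t] in \<open>simp add: field_simps power2_eq_square\<close>)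
  next
    have B: "cat_B a s \<noteq> 0" for s using cat_B_pos[OF a, of s] by simp
    assume "((\<lambda>s. cat_B a s * h s) has_real_derivative (a * sinh (2 * t) / (cat_B a t)\<^sup>2) * (cat_B a t * h t)) (at t within S)"
    from DERIV_divide[OF this cat_B_deriv[OF a] B]
    have "((\<lambda>s. cat_B a s * h s / cat_B a s) has_real_derivative 0) (at t within S)"
      by (rule DERIV_cong) (use B[of t] in \<open>simp add: field_simps power2_eq_square\<close>)
    then show "(h has_real_derivative 0) (at t within S)" using B by simp
  qed
  show ?thesis
    using key[of "cat_s0 a" "{..<cat_s0 a}"] key[of "- cat_s0 a" "{- cat_s0 a<..}"]
    by (simp add: robin_cond_def neumann_cond_def coth_cat_r[OF a])
qed

section \<open>The radial quadratic form\<close>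

text \<open>The function differentiated here is \<open>B\<^sup>2 B'\<close>, the weight of \<open>h\<^sup>2\<close> in the total derivative
  that absorbs the boundary term of the form.\<close>
lemma boundary_deriv:
  assumes a: "a > 1/2"
  shows "((\<lambda>s. a * sinh (2 * s) * cat_B a s) has_real_derivative
    2 * a * cosh (2 * s) * cat_B a s + (a * sinh (2 * s))\<^sup>2 / cat_B a s) (at s within S)"
proof -
  have "((\<lambda>s. a * sinh (2 * s)) has_real_derivative 2 * a * cosh (2 * s)) (at s within S)"
    by (auto intro!: derivative_eq_intros)
  from DERIV_mult[OF this cat_B_deriv[OF a]] show ?thesis
    by (rule DERIV_cong) (simp add: power2_eq_square)
qed

text \<open>Here \<open>x\<close> and \<open>y\<close> are the values of \<open>h\<close> and its derivative. The last summand is the derivative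
  of \<open>B\<^sup>2 B' h\<^sup>2\<close>, in the form in which the product rule for \<open>B\<^sup>2 B' \<sqdot> h \<sqdot> h\<close> produces it.\<close>
lemma radial_integrand:
  assumes a: "a > 1/2"
  shows "cat_B a s * (a * sinh (2 * s) / cat_B a s * x + cat_B a s * y)\<^sup>2
      - cat_B a s * cat_W a k s * (cat_B a s * x)\<^sup>2
    = ((cat_B a s)^3 * y\<^sup>2 + (((of_int k)\<^sup>2 - 1) * (cat_B a s)\<^sup>2 - 2 * (cat_K a)\<^sup>2) * (x\<^sup>2 / cat_B a s))
      + (x * ((2 * a * cosh (2 * s) * cat_B a s + (a * sinh (2 * s))\<^sup>2 / cat_B a s) * x + a * sinh (2 * s) * cat_B a s * y)
         + (a * sinh (2 * s) * cat_B a s) * x * y)"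
proof -
  define B where "B = cat_B a s"
  have B: "B > 0" using cat_B_pos[OF a] by (simp add: B_def)
  have C: "2 * a * cosh (2 * s) = 2 * B\<^sup>2 + 1" using cat_B_sq[OF a, of s] by (simp add: B_def)
  define \<sigma> \<kappa> where "\<sigma> = a * sinh (2 * s) / B" and "\<kappa> = (cat_K a)\<^sup>2 / B"
  have S: "a * sinh (2 * s) = \<sigma> * B" and K: "(cat_K a)\<^sup>2 = \<kappa> * B" using B by (simp_all add: \<sigma>_def \<kappa>_def)
  have "B * cat_W a k s * (B * x)\<^sup>2 = (2 * \<kappa> - 2 * B ^ 3 - (of_int k)\<^sup>2 * B) * x\<^sup>2"
  proof -
    have "B ^ 3 * cat_W a k s = 2 * \<kappa> - 2 * B ^ 3 - (of_int k)\<^sup>2 * B"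
      unfolding cat_W_def B_def[symmetric] K using B by (simp add: right_diff_distrib power3_eq_cube power4_eq_xxxx power2_eq_square)
    then show ?thesis by (simp add: power_mult_distrib power3_eq_cube power2_eq_square mult_ac)
  qed
  moreover have "\<sigma> * B / B = \<sigma>" "(\<sigma> * B)\<^sup>2 / B = \<sigma>\<^sup>2 * B"
    using B by (simp_all add: power2_eq_square)
  moreover have "(((of_int k)\<^sup>2 - 1) * B\<^sup>2 - 2 * (\<kappa> * B)) * (x\<^sup>2 / B) = (((of_int k)\<^sup>2 - 1) * B - 2 * \<kappa>) * x\<^sup>2"
    using B by (simp add: power2_eq_square field_simps)
  ultimately show ?thesis
    unfolding B_def[symmetric] C S K by (simp add: algebra_simps power2_eq_square power3_eq_cube)
qed

lemma S_rad_eq: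
  assumes a: "a > 1/2" and H1: "H1_on (cat_I a) h" and cont: "continuous_on {- cat_s0 a..cat_s0 a} h"
  shows "S_rad a k (\<lambda>s. cat_B a s * h s) =
        integral\<^sup>L (lebesgue_on (cat_I a))
          (\<lambda>s. (cat_B a s)^3 * (weak_deriv (cat_I a) h s)\<^sup>2
             + (((of_int k)\<^sup>2 - 1) * (cat_B a s)\<^sup>2 - 2 * (cat_K a)\<^sup>2) * ((h s)\<^sup>2 / cat_B a s))"
proof -
  define \<beta> where "\<beta> = cat_s0 a"
  define g where "g = weak_deriv (cat_I a) h"
  \<comment> \<open>\<open>Q = B\<^sup>2 B'\<close>, and below \<open>w\<close> is the derivative of \<open>Q h\<^sup>2\<close>.\<close>
  define Q Q' where "Q = (\<lambda>s. a * sinh (2 * s) * cat_B a s)"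
    and "Q' = (\<lambda>s. 2 * a * cosh (2 * s) * cat_B a s + (a * sinh (2 * s))\<^sup>2 / cat_B a s)"
  define B' where "B' = (\<lambda>s. a * sinh (2 * s) / cat_B a s)"
  define u' where "u' = (\<lambda>s. h s * B' s + cat_B a s * g s)"
  define R where "R = (\<lambda>s. (cat_B a s)^3 * (g s)\<^sup>2
             + (((of_int k)\<^sup>2 - 1) * (cat_B a s)\<^sup>2 - 2 * (cat_K a)\<^sup>2) * ((h s)\<^sup>2 / cat_B a s))"
  define w where "w = (\<lambda>s. h s * (h s * Q' s + Q s * g s) + (Q s * h s) * g s)"
  have \<beta>: "\<beta> > 0" using cat_s0_pos[OF a] by (simp add: \<beta>_def)
  have Bne: "cat_B a s \<noteq> 0" for s using cat_B_pos[OF a, of s] by simp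
  have contB: "continuous_on S (cat_B a)" for S by (rule cat_B_continuous[OF a])
  have h: "continuous_on {-\<beta>..\<beta>} h" using cont by (simp add: \<beta>_def)
  have g: "L2_weak_deriv_on {-\<beta><..<\<beta>} h g"
    using H1 unfolding H1_on_def g_def \<beta>_def by (blast intro: weak_deriv_is_L2_weak_deriv)
  then have L2g: "L2_on {-\<beta><..<\<beta>} g" by (simp add: L2_weak_deriv_on_def)
  have ph: "ac_primitive (-\<beta>) \<beta> h g"
    using \<beta> by (intro L2_weak_deriv_on_imp_ac_primitive h g) auto
  have contB': "continuous_on S B'" for S unfolding B'_def by (intro continuous_intros contB Bne ballI)
  have pB: "ac_primitive (-\<beta>) \<beta> (cat_B a) B'"
    by (intro ac_primitive_of_deriv contB') (simp add: B'_def cat_B_deriv[OF a])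
  have pu: "ac_primitive (-\<beta>) \<beta> (\<lambda>s. cat_B a s * h s) u'"
    using ac_primitive_mult[OF pB ph] by (simp add: u'_def)
  have hmeas: "h \<in> borel_measurable (lebesgue_on {-\<beta><..<\<beta>})"
    by (rule continuous_imp_measurable_on_sets_lebesgue) (auto intro!: continuous_on_subset[OF h])
  have "L2_on {-\<beta><..<\<beta>} h" using H1 by (simp add: H1_on_def \<beta>_def)
  then have "L2_on {-\<beta><..<\<beta>} (\<lambda>s. B' s * h s + cat_B a s * g s)"
    by (intro L2_on_add L2_on_continuous_mult contB contB' L2g)
  then have "L2_on {-\<beta><..<\<beta>} u'" by (simp add: u'_def mult.commute)
  then have AE: "AE s in lebesgue_on {-\<beta><..<\<beta>}. weak_deriv {-\<beta><..<\<beta>} (\<lambda>s. cat_B a s * h s) s = u' s"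
    using \<beta> by (intro weak_deriv_AE_eq pu) auto
  have pQ: "ac_primitive (-\<beta>) \<beta> Q Q'"
    unfolding Q_def Q'_def by (intro ac_primitive_of_deriv boundary_deriv[OF a] continuous_intros contB Bne ballI)
  have pw: "ac_primitive (-\<beta>) \<beta> (\<lambda>s. Q s * h s * h s) w"
    using ac_primitive_mult[OF ac_primitive_mult[OF pQ ph] ph] by (simp add: w_def)
  then have wabs: "w absolutely_integrable_on {-\<beta>..\<beta>}" by (simp add: ac_primitive_def)
  have Rabs: "R absolutely_integrable_on {-\<beta>..\<beta>}"
  proof -
    have "(\<lambda>s. (g s)\<^sup>2) absolutely_integrable_on {-\<beta>..\<beta>}"
      using L2g by (simp add: L2_on_def absolutely_integrable_on_iff_integrable absolutely_integrable_on_Icc_iff_Ioo)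
    then have "(\<lambda>s. (cat_B a s) ^ 3 * (g s)\<^sup>2) absolutely_integrable_on {-\<beta>..\<beta>}"
      by (intro absolutely_integrable_continuous_mult continuous_intros contB)
    then show ?thesis unfolding R_def
      by (rule set_integral_add(1))
        (intro absolutely_integrable_continuous_real continuous_intros contB h Bne ballI)
  qed
  note int = integral_lebesgue_on_Ioo[OF Rabs] integral_lebesgue_on_Ioo[OF wabs]
  have pt: "cat_B a s * (u' s)\<^sup>2 - cat_B a s * cat_W a k s * (cat_B a s * h s)\<^sup>2 = R s + w s" for s
    using radial_integrand[OF a, of s "h s" "g s" k]
    by (simp add: u'_def B'_def R_def w_def Q_def Q'_def mult_ac)
  have "integral\<^sup>L (lebesgue_on {-\<beta><..<\<beta>}) (\<lambda>s. cat_B a s * (weak_deriv {-\<beta><..<\<beta>} (\<lambda>s. cat_B a s * h s) s)\<^sup>2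
          - cat_B a s * cat_W a k s * (cat_B a s * h s)\<^sup>2)
      = integral\<^sup>L (lebesgue_on {-\<beta><..<\<beta>}) (\<lambda>s. R s + w s)"
  proof (rule integral_cong_AE)
    have "L2_weak_deriv_on {-\<beta><..<\<beta>} (\<lambda>s. cat_B a s * h s) (weak_deriv {-\<beta><..<\<beta>} (\<lambda>s. cat_B a s * h s))"
      by (rule weak_deriv_is_L2_weak_deriv, rule ac_primitive_imp_L2_weak_deriv_on[OF pu _ \<open>L2_on {-\<beta><..<\<beta>} u'\<close>]) (use \<beta> in simp)
    then have [measurable]: "weak_deriv {-\<beta><..<\<beta>} (\<lambda>s. cat_B a s * h s) \<in> borel_measurable (lebesgue_on {-\<beta><..<\<beta>})"
      by (simp add: L2_weak_deriv_on_def L2_on_def)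
    note [measurable] = hmeas
    have [measurable]: "cat_B a \<in> borel_measurable (lebesgue_on {-\<beta><..<\<beta>})"
      by (rule continuous_imp_measurable_on_sets_lebesgue) (auto intro: contB)
    show "(\<lambda>s. cat_B a s * (weak_deriv {-\<beta><..<\<beta>} (\<lambda>s. cat_B a s * h s) s)\<^sup>2
          - cat_B a s * cat_W a k s * (cat_B a s * h s)\<^sup>2) \<in> borel_measurable (lebesgue_on {-\<beta><..<\<beta>})"
      unfolding cat_W_def by measurable
    show "(\<lambda>s. R s + w s) \<in> borel_measurable (lebesgue_on {-\<beta><..<\<beta>})"
      using int by (intro borel_measurable_integrable) simp
    show "AE s in lebesgue_on {-\<beta><..<\<beta>}. cat_B a s * (weak_deriv {-\<beta><..<\<beta>} (\<lambda>s. cat_B a s * h s) s)\<^sup>2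
          - cat_B a s * cat_W a k s * (cat_B a s * h s)\<^sup>2 = R s + w s"
      using AE by eventually_elim (simp add: pt)
  qed
  also have "\<dots> = integral\<^sup>L (lebesgue_on {-\<beta><..<\<beta>}) R + (Q \<beta> * h \<beta> * h \<beta> - Q (-\<beta>) * h (-\<beta>) * h (-\<beta>))"
    using int ac_primitive_integral[OF pw] \<beta> by simp
  also have "Q \<beta> * h \<beta> * h \<beta> - Q (-\<beta>) * h (-\<beta>) * h (-\<beta>)
      = coth (cat_r a) * cat_B a \<beta> * ((cat_B a \<beta> * h \<beta>)\<^sup>2 + (cat_B a (-\<beta>) * h (-\<beta>))\<^sup>2)"
    using Bne[of \<beta>] by (simp add: Q_def coth_cat_r[OF a, folded \<beta>_def] field_simps power2_eq_square)
  finally show ?thesis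
    unfolding S_rad_def \<beta>_def[symmetric] g_def[unfolded \<beta>_def[symmetric], symmetric] R_def by simp
qed

theorem lemma9p3:
  fixes a :: real and h :: "real \<Rightarrow> real"
  assumes "a > 1 / 2"
    and "H1_on (cat_I a) h"
    and "continuous_on {- cat_s0 a..cat_s0 a} h"
  shows "(robin_cond a (\<lambda>s. cat_B a s * h s) \<longleftrightarrow> neumann_cond a h) \<and>
    (robin_cond a (\<lambda>s. cat_B a s * h s) \<longrightarrow>
      (\<forall>k::int. S_rad a k (\<lambda>s. cat_B a s * h s) =
        integral\<^sup>L (lebesgue_on (cat_I a))
          (\<lambda>s. (cat_B a s)^3 * (weak_deriv (cat_I a) h s)\<^sup>2
             + (((of_int k)\<^sup>2 - 1) * (cat_B a s)\<^sup>2 - 2 * (cat_K a)\<^sup>2) * ((h s)\<^sup>2 / cat_B a s))))"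
  using robin_iff_neumann[OF assms(1)] S_rad_eq[OF assms] by blast

end
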